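(* Assume $r=0$ and that the parameters are regular and admissible. Let $(\boldsymbol n,\boldsymbol m)\in\mathbb N_0^p\times\mathbb N_0^q$ with $|\boldsymbol m|=|\boldsymbol n|+1$ and $\boldsymbol m$ near the diagonal. Put $m_*=\max_jm_j$, $\mathsf H=\{j:m_j=m_*\}$, and let $\mathbf v^{\mathsf H}\in\mathbb C^{1\times q}$ have components $v^{\mathsf H}_j=\prod_{\ell\in\mathsf H,\ell\ne j}(b_\ell-b_j)^{-1}$ for $j\in\mathsf H$ and $v^{\mathsf H}_j=0$ for $j\notin\mathsf H$. Let $\omega$ be any word of length $|\boldsymbol n|$ in which each index $i\in\{1,\dots,p\}$ occurs exactly $n_i$ times. Then, up to a nonzero normalization constant, $$\mathbf B_{\boldsymbol n,\boldsymbol m}(z)=\mathcal U^0_\omega\big[z^{m_*-1-|\boldsymbol n|}\,\mathbf v^{\mathsf H}\big](z).$$ (The constant is fixed by requiring a chosen component indexed by $\mathsf H$ to be monic.)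
   Context: Notation. $\mathbf 1_q=(1,\dots,1)$; $|\boldsymbol n|=\sum n_i$. $\mathbb P_N$: polynomials of degree $\le N$, $\mathbb P_{-1}=\{0\}$. $\mathbb T$: positively oriented unit circle. $\mathbb Z_{\le0}=\{0,-1,\dots\}$. Parameters ($r=0$): $p,q\ge1$, $\boldsymbol b\in\mathbb C^q$, $\boldsymbol\kappa\in\mathbb C^p$. Regular: $b_j-b_h\notin\mathbb Z$ $(j\ne h)$, $\kappa_i-\kappa_h\notin\mathbb Z$ $(i\ne h)$. Admissible: $\kappa_i+b_j+1\notin\mathbb Z_{\le0}$ for all $i,j$. Weights: $C_{j,i}(z)=\sum_{k\ge0}\dfrac{z^{-k-1}}{\Gamma(k+\kappa_i+b_j+2)\prod_{h\ne j}\Gamma(k+\kappa_i+b_h+1)}$, $z\ne0$. $\boldsymbol m$ near the diagonal: $|m_j-m_h|\le1$ for all $j,h$. $\mathbf B_{\boldsymbol n,\boldsymbol m}$ denotes the $B$-polynomial vector: the nonzero row vector $(B^{(1)},\dots,B^{(q)})$, unique up to a nonzero scalar under these hypotheses, with $B^{(j)}\in\mathbb P_{m_j-1}$ and $\sum_{j=1}^q\oint_{\mathbb T}z^\ell B^{(j)}(z)C_{j,i}(z)\frac{\mathrm dz}{2\pi\mathrm i}=0$ for $1\le i\le p$, $0\le\ell\le n_i-1$. Operators on row-vector Laurent polynomials $\mathbf P\in\mathbb C[z,z^{-1}]^{1\times q}$: let $\vartheta=z\,\mathrm d/\mathrm dz$, $D=\operatorname{diag}(b_1,\dots,b_q)$,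 $\lambda^0_j=\prod_{\ell\ne j}(b_\ell-b_j)^{-1}$, $\lambda^0=(\lambda^0_1,\dots,\lambda^0_q)$, and $$\mathcal T^0_{i,s}[\mathbf P]=-z\big(\vartheta\mathbf P+\mathbf PD+(\kappa_i+s+2)\mathbf P\big)+(\mathbf P\mathbf 1_q^{\mathsf T})\,\lambda^0,\qquad 1\le i\le p,\ s\in\mathbb N_0 .$$ For a word $\omega=(i_0,\dots,i_{N-1})$, $N=|\boldsymbol n|$, set $\rho_c=\#\{d>c:\ i_d=i_c\}$, $s_c=N-1-c+\rho_c$ for $0\le c\le N-1$, and $$\mathcal U^0_\omega=\mathcal T^0_{i_{N-1},s_{N-1}}\cdots\mathcal T^0_{i_1,s_1}\mathcal T^0_{i_0,s_0}$$ (the rightmost factor acts first; identity if $N=0$). *)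

theory Defs
  imports
    "HOL-Complex_Analysis.Complex_Analysis"
    "HOL-Computational_Algebra.Formal_Laurent_Series"
    "HOL-Computational_Algebra.Polynomial_FPS"
begin

text \<open>
  The index sets \<open>{1..p}\<close> and \<open>{1..q}\<close> are arbitrary finite (nonempty) types \<open>'p\<close> and \<open>'q\<close>;
  vectors and multi-indices are functions on them.
\<close>

definition regular :: "('p::finite \<Rightarrow> complex) \<Rightarrow> ('q::finite \<Rightarrow> complex) \<Rightarrow> bool" where
  "regular \<kappa> b \<longleftrightarrow>
     (\<forall>j h. j \<noteq> h \<longrightarrow> b j - b h \<notin> \<int>) \<and> (\<forall>i h. i \<noteq> h \<longrightarrow> \<kappa> i - \<kappa> h \<notin> \<int>)"

definition admissible :: "('p::finite \<Rightarrow> complex) \<Rightarrow> ('q::finite \<Rightarrow> complex) \<Rightarrow> bool" where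
  "admissible \<kappa> b \<longleftrightarrow> (\<forall>i j. \<kappa> i + b j + 1 \<notin> \<int>\<^sub>\<le>\<^sub>0)"

definition near_diagonal :: "('q::finite \<Rightarrow> nat) \<Rightarrow> bool" where
  "near_diagonal m \<longleftrightarrow> (\<forall>j h. \<bar>int (m j) - int (m h)\<bar> \<le> 1)"

definition weight ::
  "('p::finite \<Rightarrow> complex) \<Rightarrow> ('q::finite \<Rightarrow> complex) \<Rightarrow> 'q \<Rightarrow> 'p \<Rightarrow> complex \<Rightarrow> complex" where
  "weight \<kappa> b j i z =
     (\<Sum>k. z powi (- int k - 1) /
        (Gamma (of_nat k + \<kappa> i + b j + 2) *
         (\<Prod>h\<in>UNIV - {j}. Gamma (of_nat k + \<kappa> i + b h + 1))))"

text \<open>The degree bound is an integer, so that \<open>polys_le (-1) = {0}\<close>.\<close>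

definition polys_le :: "int \<Rightarrow> complex poly set" where
  "polys_le N = {P. P = 0 \<or> int (degree P) \<le> N}"

definition is_B_vector ::
  "('p::finite \<Rightarrow> complex) \<Rightarrow> ('q::finite \<Rightarrow> complex) \<Rightarrow> ('p \<Rightarrow> nat) \<Rightarrow> ('q \<Rightarrow> nat) \<Rightarrow>
   ('q \<Rightarrow> complex poly) \<Rightarrow> bool" where
  "is_B_vector \<kappa> b n m B \<longleftrightarrow>
     (\<exists>j. B j \<noteq> 0) \<and>
     (\<forall>j. B j \<in> polys_le (int (m j) - 1)) \<and>
     (\<forall>i. \<forall>l<n i.
        (\<Sum>j\<in>UNIV. contour_integral (circlepath 0 1)
           (\<lambda>z. z ^ l * poly (B j) z * weight \<kappa> b j i z / (2 * of_real pi * \<i>))) = 0)"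

text \<open>
  Laurent polynomials are treated as elements of the library's ring of formal Laurent series;
  \<open>op_T\<close> maps Laurent polynomial vectors to Laurent polynomial vectors.
\<close>

definition theta :: "complex fls \<Rightarrow> complex fls" where
  "theta f = fls_X * fls_deriv f"

definition lambda0 :: "('q::finite \<Rightarrow> complex) \<Rightarrow> 'q \<Rightarrow> complex" where
  "lambda0 b j = (\<Prod>l\<in>UNIV - {j}. inverse (b l - b j))"

definition op_T ::
  "('p::finite \<Rightarrow> complex) \<Rightarrow> ('q::finite \<Rightarrow> complex) \<Rightarrow> 'p \<Rightarrow> nat \<Rightarrow>
   ('q \<Rightarrow> complex fls) \<Rightarrow> ('q \<Rightarrow> complex fls)" where
  "op_T \<kappa> b i s P = (\<lambda>j.
     - (fls_X * (theta (P j) + P j * fls_const (b j) + fls_const (\<kappa> i + of_nat s + 2) * P j))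
     + (\<Sum>l\<in>UNIV. P l) * fls_const (lambda0 b j))"

definition word_rho :: "'p list \<Rightarrow> nat \<Rightarrow> nat" where
  "word_rho \<omega> c = card {d. c < d \<and> d < length \<omega> \<and> \<omega> ! d = \<omega> ! c}"

text \<open>Only used for \<open>c < length \<omega>\<close>, where the natural-number subtractions do not truncate.\<close>

definition word_s :: "'p list \<Rightarrow> nat \<Rightarrow> nat" where
  "word_s \<omega> c = length \<omega> - 1 - c + word_rho \<omega> c"

text \<open>\<open>fold\<close> applies the operator of the first letter first.\<close>

definition op_U ::
  "('p::finite \<Rightarrow> complex) \<Rightarrow> ('q::finite \<Rightarrow> complex) \<Rightarrow> 'p list \<Rightarrow>
   ('q \<Rightarrow> complex fls) \<Rightarrow> ('q \<Rightarrow> complex fls)" where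
  "op_U \<kappa> b \<omega> P = fold (\<lambda>c. op_T \<kappa> b (\<omega> ! c) (word_s \<omega> c)) [0..<length \<omega>] P"

definition mstar :: "('q::finite \<Rightarrow> nat) \<Rightarrow> nat" where
  "mstar m = Max (range m)"

definition Hset :: "('q::finite \<Rightarrow> nat) \<Rightarrow> 'q set" where
  "Hset m = {j. m j = mstar m}"

definition vH :: "('q::finite \<Rightarrow> complex) \<Rightarrow> ('q \<Rightarrow> nat) \<Rightarrow> 'q \<Rightarrow> complex" where
  "vH b m j =
     (if j \<in> Hset m then (\<Prod>l\<in>Hset m - {j}. inverse (b l - b j)) else 0)"

text \<open>The Laurent monomial vector \<open>z^e v\<close>, for an integer exponent \<open>e\<close>.\<close>

definition laurent_monom :: "int \<Rightarrow> ('q::finite \<Rightarrow> complex) \<Rightarrow> 'q \<Rightarrow> complex fls" where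
  "laurent_monom e v = (\<lambda>j. fls_const (v j) * fls_X_intpow e)"

end

theory Submission
  imports Defs
begin

text \<open>
  Write the weight coefficients as values \<open>f\<^sub>j(\<kappa>\<^sub>i + k)\<close> of the entire functions
  \<open>f\<^sub>j(x) = 1 / (\<Gamma>(x + b\<^sub>j + 2) \<Prod>\<^bsub>h \<noteq> j\<^esub> \<Gamma>(x + b\<^sub>h + 1))\<close>, and attach to a Laurent polynomial
  vector \<open>P\<close> the function \<open>F\<^sub>P(x) = \<Sum>\<^sub>j \<Sum>\<^sub>t P\<^sub>j\<^sub>,\<^sub>t f\<^sub>j(x + t)\<close>. The orthogonality relations say
  that \<open>F\<^sub>B\<close> vanishes at the points \<open>\<kappa>\<^sub>i + l\<close> with \<open>l < n\<^sub>i\<close>. Partial fractions give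
  \<open>F\<^bsub>T P\<^esub>(x) = (x - \<kappa>\<^sub>i - s) F\<^sub>P(x + 1)\<close> for \<open>T = op_T \<kappa> b i s\<close>, so the shifts \<open>s\<^sub>c\<close> are exactly
  those for which the word produces
  \<open>F\<^sub>U(x) = \<Prod>\<^sub>i \<Prod>\<^bsub>l < n i\<^esub> (x - \<kappa>\<^sub>i - l) / \<Prod>\<^sub>h \<Gamma>(x + m\<^sub>h + b\<^sub>h + 1)\<close>, independently of its order.

  For a \<open>B\<close>-vector, \<open>F\<^sub>B\<close> has the same denominator and a numerator of degree at most \<open>|n|\<close> which
  vanishes at \<open>|n|\<close> distinct points; hence \<open>F\<^sub>B\<close> is a multiple of \<open>F\<^sub>U\<close>. Evaluating \<open>F\<^sub>P\<close> at
  \<open>x = -t - b\<^sub>j - 1\<close>, with \<open>t\<close> the top exponent of \<open>P\<close>, isolates the coefficient \<open>P\<^sub>j\<^sub>,\<^sub>t\<close>; hence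
  \<open>P \<mapsto> F\<^sub>P\<close> is injective and \<open>B\<close> is a multiple of \<open>U\<close>. Existence of a \<open>B\<close>-vector comes from counting
  equations and unknowns, which also shows indirectly that \<open>U\<close> has no negative powers.
\<close>

text \<open>\<open>weight_kernel b j (\<kappa> i + k)\<close> is the coefficient of \<open>z^(-k-1)\<close> in \<open>weight \<kappa> b j i z\<close>,
  continued to an entire function of the index.\<close>

definition weight_kernel :: "('q::finite \<Rightarrow> complex) \<Rightarrow> 'q \<Rightarrow> complex \<Rightarrow> complex" where
  "weight_kernel b j x = rGamma (x + b j + 2) * (\<Prod>h\<in>UNIV - {j}. rGamma (x + b h + 1))"

text \<open>Formal Laurent series may have infinitely many terms. This singles out the Laurent
  polynomials, for which the inner sums of \<open>moment_transform\<close> are finite instead of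
  taking the default value 0.\<close>

definition laurent_vec :: "('q \<Rightarrow> complex fls) \<Rightarrow> bool" where
  "laurent_vec P \<longleftrightarrow> (\<forall>j. finite {t. fls_nth (P j) t \<noteq> 0})"

definition moment_transform ::
  "('q::finite \<Rightarrow> complex) \<Rightarrow> ('q \<Rightarrow> complex fls) \<Rightarrow> complex \<Rightarrow> complex" where
  "moment_transform b P x =
     (\<Sum>j\<in>UNIV. \<Sum>t | fls_nth (P j) t \<noteq> 0. fls_nth (P j) t * weight_kernel b j (x + of_int t))"

section \<open>Partial fractions for the kernel\<close>

lemma rGamma_plus2: "(z + 1) * rGamma (z + 2) = rGamma (z + 1 :: complex)"
  using rGamma_plus1[of "z + 1"] by (simp add: add.assoc)

lemma prod_rGamma_eq_kernel:
  "(\<Prod>h\<in>UNIV. rGamma (x + b h + 1)) = (x + b j + 1) * weight_kernel b j x"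
  by (subst prod.remove[of UNIV j])
     (simp_all add: weight_kernel_def rGamma_plus2[symmetric] mult.assoc)

lemma lagrange_basis_sum:
  fixes a :: "'q \<Rightarrow> complex"
  assumes "finite H" "H \<noteq> {}" "inj_on a H"
  shows "(\<Sum>j\<in>H. \<Prod>h\<in>H - {j}. (x - a h) / (a j - a h)) = 1"
proof -
  define L where "L = (\<lambda>j. \<Prod>h\<in>H - {j}. smult (inverse (a j - a h)) [:- a h, 1:])"
  have L: "poly (L j) y = (\<Prod>h\<in>H - {j}. (y - a h) / (a j - a h))" for j y
    unfolding L_def poly_prod by (intro prod.cong) (auto simp: divide_inverse algebra_simps)
  have card: "card H > 0"
    using assms by (simp add: card_gt_0_iff)
  have deg: "degree (L j) < card H" if "j \<in> H" for j
  proof -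
    have "degree (L j) \<le> sum (degree \<circ> (\<lambda>h. smult (inverse (a j - a h)) [:- a h, 1:])) (H - {j})"
      unfolding L_def by (rule degree_prod_sum_le) (use assms in auto)
    also have "\<dots> \<le> (\<Sum>h\<in>H - {j}. 1)"
      by (intro sum_mono) simp
    also have "\<dots> < card H"
      using that assms card by simp
    finally show ?thesis .
  qed
  have "(\<Sum>j\<in>H. L j) = 1"
  proof (rule poly_eqI_degree[of "a ` H"])
    fix y assume "y \<in> a ` H"
    then obtain k where k: "k \<in> H" "y = a k" by auto
    have "poly (L j) y = (if j = k then 1 else 0)" if "j \<in> H" for j
    proof (cases "j = k")
      case True
      then show ?thesis
        unfolding L k(2) True using assms(3) k(1)
        by (auto intro!: prod.neutral dest: inj_onD split: if_splits)
    next
      case False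
      then show ?thesis
        unfolding L using assms(1) k by (auto intro!: bexI[of _ k])
    qed
    then show "poly (\<Sum>j\<in>H. L j) y = poly 1 y"
      using k assms(1) by (simp add: poly_sum)
  next
    show "degree (\<Sum>j\<in>H. L j) < card (a ` H)"
      using assms card deg by (auto simp: card_image intro!: degree_sum_less)
  qed (use assms card in \<open>simp add: card_image\<close>)
  then have "poly (\<Sum>j\<in>H. L j) x = 1" by simp
  then show ?thesis by (simp add: poly_sum L)
qed

text \<open>Relative to the common product \<open>?R\<close>, the kernel of index j in
  \<open>H\<close> has the numerator \<Prod>(x + b_h + 1) over the other h in \<open>H\<close>. The
  coefficients turn these numerators into the Lagrange basis for the nodes -b_h - 1. The case
  \<open>H = UNIV\<close> serves \<open>lambda0\<close>, the case \<open>H = Hset m\<close> serves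
  \<open>vH\<close>.\<close>

lemma sum_lagrange_weight_kernel:
  assumes "inj b" "H \<noteq> {}"
  shows "(\<Sum>j\<in>H. (\<Prod>l\<in>H - {j}. inverse (b l - b j)) * weight_kernel b j x) =
    (\<Prod>h\<in>UNIV. rGamma (x + b h + (if h \<in> H then 2 else 1)))" (is "_ = ?R")
proof -
  have weight_kernel: "weight_kernel b j x = (\<Prod>h\<in>H - {j}. x + b h + 1) * ?R" if "j \<in> H" for j
  proof -
    have "rGamma (x + b h + 1) =
        (if h \<in> H then x + b h + 1 else 1) * rGamma (x + b h + (if h \<in> H then 2 else 1))" for h
      by (simp add: rGamma_plus2)
    then have "weight_kernel b j x = rGamma (x + b j + 2) *
        ((\<Prod>h\<in>UNIV - {j}. if h \<in> H then x + b h + 1 else 1) *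
         (\<Prod>h\<in>UNIV - {j}. rGamma (x + b h + (if h \<in> H then 2 else 1))))"
      unfolding weight_kernel_def by (simp add: prod.distrib)
    also have "(\<Prod>h\<in>UNIV - {j}. if h \<in> H then x + b h + 1 else 1) = (\<Prod>h\<in>H - {j}. x + b h + 1)"
      by (rule prod.mono_neutral_cong_right) auto
    also have "?R = rGamma (x + b j + 2) *
         (\<Prod>h\<in>UNIV - {j}. rGamma (x + b h + (if h \<in> H then 2 else 1)))"
      by (subst prod.remove[of UNIV j]) (use that in auto)
    ultimately show ?thesis by (simp add: mult_ac)
  qed
  have "(\<Sum>j\<in>H. (\<Prod>l\<in>H - {j}. inverse (b l - b j)) * weight_kernel b j x) =
     (\<Sum>j\<in>H. \<Prod>h\<in>H - {j}. (x - (- b h - 1)) / ((- b j - 1) - (- b h - 1))) * ?R"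
    unfolding sum_distrib_right
    by (intro sum.cong) (simp_all add: weight_kernel prod.distrib[symmetric] field_simps flip: mult.assoc)
  also have "(\<Sum>j\<in>H. \<Prod>h\<in>H - {j}. (x - (- b h - 1)) / ((- b j - 1) - (- b h - 1))) = 1"
    by (rule lagrange_basis_sum) (use assms in \<open>auto simp: inj_on_def\<close>)
  finally show ?thesis by simp
qed

section \<open>The action of \<open>op_T\<close> on moment transforms\<close>

lemma moment_transform_eq_sum:
  assumes "finite S" "\<And>j t. t \<notin> S \<Longrightarrow> fls_nth (P j) t = 0"
  shows "moment_transform b P x = (\<Sum>j\<in>UNIV. \<Sum>t\<in>S. fls_nth (P j) t * weight_kernel b j (x + of_int t))"
  unfolding moment_transform_def
  by (intro sum.cong refl sum.mono_neutral_left) (use assms in auto)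

lemma laurent_vecE:
  fixes P :: "'q::finite \<Rightarrow> complex fls"
  assumes "laurent_vec P"
  obtains S where "finite S" "\<And>j t. t \<notin> S \<Longrightarrow> fls_nth (P j) t = 0"
proof
  show "finite (\<Union>j. {t. fls_nth (P j) t \<noteq> 0})"
    using assms by (simp add: laurent_vec_def)
qed auto

lemma laurent_vecI:
  assumes "finite S" "\<And>j t. t \<notin> S \<Longrightarrow> fls_nth (P j) t = 0"
  shows "laurent_vec P"
  unfolding laurent_vec_def
proof
  fix j
  show "finite {t. fls_nth (P j) t \<noteq> 0}"
    by (rule finite_subset[OF _ assms(1)]) (use assms(2) in auto)
qed

lemma op_T_nth:
  "fls_nth (op_T \<kappa> b i s P j) t =
     (\<Sum>l\<in>UNIV. fls_nth (P l) t) * lambda0 b j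
     - (of_int (t - 1) + b j + \<kappa> i + of_nat s + 2) * fls_nth (P j) (t - 1)"
proof -
  have "fls_nth (\<Sum>l\<in>UNIV. P l) t = (\<Sum>l\<in>UNIV. fls_nth (P l) t)"
    by (simp add: fls_nth_sum)
  then show ?thesis
    by (simp add: op_T_def theta_def fls_X_times_conv_shift algebra_simps)
qed

lemma laurent_vec_op_T:
  assumes "laurent_vec P"
  shows "laurent_vec (op_T \<kappa> b i s P)"
proof -
  from assms obtain S where S: "finite S" "\<And>j t. t \<notin> S \<Longrightarrow> fls_nth (P j) t = 0"
    using laurent_vecE by blast
  show ?thesis
  proof (rule laurent_vecI)
    show "finite (S \<union> (\<lambda>t. t + 1) ` S)" using S by simp
    fix j t assume t: "t \<notin> S \<union> (\<lambda>t. t + 1) ` S"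
    then have "t - 1 \<notin> S" by force
    with t show "fls_nth (op_T \<kappa> b i s P j) t = 0"
      by (simp add: op_T_nth S)
  qed
qed

text \<open>For each coefficient P_{j,t}, the \<open>lambda0\<close> term contributes x + t + b_j +
  2 times the kernel at x + 1 + t, and the remaining term, after moving t by one, subtracts t + b_j
  + \<kappa>_i + s + 2 times the same kernel value. The difference of the two factors depends on
  neither j nor t.\<close>

lemma moment_transform_op_T:
  assumes "laurent_vec P" "inj b"
  shows "moment_transform b (op_T \<kappa> b i s P) x = (x - \<kappa> i - of_nat s) * moment_transform b P (x + 1)"
proof -
  from assms(1) obtain S where S: "finite S" "\<And>j t. t \<notin> S \<Longrightarrow> fls_nth (P j) t = 0"
    using laurent_vecE by blast
  \<comment> \<open>Multiplication by z moves exponents up by one, so this set contains the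
    exponents of both parts of \<open>op_T\<close>.\<close>
  define S' where "S' = S \<union> (\<lambda>t. t + 1) ` S"
  define g where "g = (\<lambda>t. \<Prod>h\<in>UNIV. rGamma (x + of_int t + b h + 2))"
  have fin: "finite S'" using S by (simp add: S'_def)
  have S'0: "fls_nth (P j) t = 0" if "t \<notin> S'" for j t
    using that S by (auto simp: S'_def)
  have S'1: "fls_nth (P j) (t - 1) = 0" if "t \<notin> S'" for j t
  proof -
    have "t - 1 \<notin> S" using that unfolding S'_def by force
    then show ?thesis by (rule S)
  qed
  have lam: "(\<Sum>j\<in>UNIV. lambda0 b j * weight_kernel b j y) = (\<Prod>h\<in>UNIV. rGamma (y + b h + 2))" for y
    using sum_lagrange_weight_kernel[OF assms(2), of UNIV y] by (simp add: lambda0_def)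
  have g: "g t = (x + of_int t + b j + 2) * weight_kernel b j (x + of_int t + 1)" for j t
    using prod_rGamma_eq_kernel[of "x + of_int t + 1" b j] by (simp add: g_def algebra_simps)
  have "moment_transform b (op_T \<kappa> b i s P) x =
     (\<Sum>j\<in>UNIV. \<Sum>t\<in>S'. fls_nth (op_T \<kappa> b i s P j) t * weight_kernel b j (x + of_int t))"
    by (rule moment_transform_eq_sum) (simp_all add: fin op_T_nth S'0 S'1)
  also have "\<dots> = (\<Sum>j\<in>UNIV. \<Sum>t\<in>S'. (\<Sum>l\<in>UNIV. fls_nth (P l) t) * (lambda0 b j * weight_kernel b j (x + of_int t)))
     - (\<Sum>j\<in>UNIV. \<Sum>t\<in>S'. (of_int (t - 1) + b j + \<kappa> i + of_nat s + 2) * fls_nth (P j) (t - 1)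
          * weight_kernel b j (x + of_int t))"
    by (simp add: op_T_nth sum_subtractf left_diff_distrib mult.assoc)
  also have "(\<Sum>j\<in>UNIV. \<Sum>t\<in>S'. (\<Sum>l\<in>UNIV. fls_nth (P l) t) * (lambda0 b j * weight_kernel b j (x + of_int t)))
     = (\<Sum>t\<in>S'. (\<Sum>l\<in>UNIV. fls_nth (P l) t) * g t)"
    by (subst sum.swap) (simp add: sum_distrib_left[symmetric] lam[of "x + of_int _"] g_def)
  also have "\<dots> = (\<Sum>j\<in>UNIV. \<Sum>t\<in>S'. fls_nth (P j) t * g t)"
    by (subst sum.swap) (simp add: sum_distrib_right)
  also have "\<dots> = (\<Sum>j\<in>UNIV. \<Sum>t\<in>S. fls_nth (P j) t *
       ((x + of_int t + b j + 2) * weight_kernel b j (x + of_int t + 1)))"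
    unfolding g[symmetric]
    by (intro sum.cong refl sum.mono_neutral_right) (use fin S in \<open>auto simp: S'_def\<close>)
  also have "(\<Sum>j\<in>UNIV. \<Sum>t\<in>S'. (of_int (t - 1) + b j + \<kappa> i + of_nat s + 2) * fls_nth (P j) (t - 1)
          * weight_kernel b j (x + of_int t)) =
     (\<Sum>j\<in>UNIV. \<Sum>t\<in>(\<lambda>t. t + 1) ` S. (of_int (t - 1) + b j + \<kappa> i + of_nat s + 2) * fls_nth (P j) (t - 1)
          * weight_kernel b j (x + of_int t))"
  proof (rule sum.cong[OF refl], rule sum.mono_neutral_right)
    fix j
    have "t - 1 \<notin> S" if "t \<in> S' - (\<lambda>t. t + 1) ` S" for t
      using that by force
    then show "\<forall>t\<in>S' - (\<lambda>t. t + 1) ` S. (of_int (t - 1) + b j + \<kappa> i + of_nat s + 2) *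
        fls_nth (P j) (t - 1) * weight_kernel b j (x + of_int t) = 0"
      by (simp add: S)
  qed (use fin in \<open>auto simp: S'_def\<close>)
  also have "\<dots> = (\<Sum>j\<in>UNIV. \<Sum>t\<in>S. (of_int t + b j + \<kappa> i + of_nat s + 2) * fls_nth (P j) t
          * weight_kernel b j (x + of_int t + 1))"
    by (simp add: sum.reindex inj_on_def add_ac)
  also have "(\<Sum>j\<in>UNIV. \<Sum>t\<in>S. fls_nth (P j) t *
       ((x + of_int t + b j + 2) * weight_kernel b j (x + of_int t + 1))) - \<dots> =
     (x - \<kappa> i - of_nat s) * (\<Sum>j\<in>UNIV. \<Sum>t\<in>S. fls_nth (P j) t * weight_kernel b j ((x + 1) + of_int t))"
    unfolding sum_subtractf[symmetric] sum_distrib_left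
    by (intro sum.cong refl) (simp add: algebra_simps)
  also have "(\<Sum>j\<in>UNIV. \<Sum>t\<in>S. fls_nth (P j) t * weight_kernel b j ((x + 1) + of_int t)) = moment_transform b P (x + 1)"
    by (rule moment_transform_eq_sum[symmetric]) (use S in auto)
  finally show ?thesis .
qed

section \<open>Words and composed operators\<close>

lemma word_rho_Cons:
  "word_rho (a # \<omega>) 0 = count_list \<omega> a" "word_rho (a # \<omega>) (Suc c) = word_rho \<omega> c"
proof -
  have shift: "{d. 0 < d \<and> d < Suc N \<and> Q (d - 1)} = Suc ` {d. d < N \<and> Q d}" for N Q
    by (auto simp: image_iff gr0_conv_Suc)
  have "word_rho (a # \<omega>) 0 = card {d. 0 < d \<and> d < Suc (length \<omega>) \<and> \<omega> ! (d - 1) = a}"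
    unfolding word_rho_def by (intro arg_cong[where f = card] Collect_cong) (auto simp: nth_Cons')
  also have "\<dots> = card {d. d < length \<omega> \<and> \<omega> ! d = a}"
    by (subst shift) (simp add: card_image)
  also have "\<dots> = count_list \<omega> a"
    by (simp add: count_list_eq_length_filter length_filter_conv_card eq_commute)
  finally show "word_rho (a # \<omega>) 0 = count_list \<omega> a" .
  have "{d. Suc c < d \<and> d < length (a # \<omega>) \<and> (a # \<omega>) ! d = (a # \<omega>) ! Suc c} =
     Suc ` {d. c < d \<and> d < length \<omega> \<and> \<omega> ! d = \<omega> ! c}"
    by (auto simp: image_iff nth_Cons' gr0_conv_Suc dest: Suc_lessE)
  then show "word_rho (a # \<omega>) (Suc c) = word_rho \<omega> c"
    unfolding word_rho_def by (simp add: card_image)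
qed

lemma word_s_Cons:
  "word_s (a # \<omega>) 0 = length \<omega> + count_list \<omega> a"
  "word_s (a # \<omega>) (Suc c) = word_s \<omega> c"
  by (simp_all add: word_s_def word_rho_Cons)

lemma op_U_Nil [simp]: "op_U \<kappa> b [] P = P"
  by (simp add: op_U_def)

text \<open>The shift at a position depends only on the letters from there on, so removing the first
  letter leaves the other shifts unchanged.\<close>

lemma op_U_Cons:
  "op_U \<kappa> b (a # \<omega>) P = op_U \<kappa> b \<omega> (op_T \<kappa> b a (length \<omega> + count_list \<omega> a) P)"
proof -
  have "[0..<length (a # \<omega>)] = 0 # map Suc [0..<length \<omega>]"
    by (simp add: map_Suc_upt upt_conv_Cons del: upt_Suc)
  then show ?thesis
    unfolding op_U_def by (simp add: fold_map word_s_Cons comp_def del: upt_Suc)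
qed

lemma laurent_vec_op_U: "laurent_vec P \<Longrightarrow> laurent_vec (op_U \<kappa> b \<omega> P)"
  by (induction \<omega> arbitrary: P) (simp_all add: op_U_Cons laurent_vec_op_T)

text \<open>The letters after \<open>a\<close> translate the argument by
  \<open>length \<omega>\<close> before the factor of \<open>a\<close> is evaluated. This cancels
  the same summand of its shift, and what remains is the next zero \<kappa>_a +
  \<open>count_list \<omega> a\<close>. The resulting product does not see the order of the
  letters.\<close>

lemma moment_transform_op_U:
  fixes \<kappa> :: "'p::finite \<Rightarrow> complex"
  assumes "laurent_vec P" "inj b"
  shows "moment_transform b (op_U \<kappa> b \<omega> P) x =
     (\<Prod>i\<in>UNIV. \<Prod>l<count_list \<omega> i. x - \<kappa> i - of_nat l) * moment_transform b P (x + of_nat (length \<omega>))"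
  using assms(1)
proof (induction \<omega> arbitrary: P)
  case (Cons a \<omega>)
  let ?f = "\<lambda>\<omega> i. \<Prod>l<count_list \<omega> i. x - \<kappa> i - of_nat l"
  have "(\<Prod>i\<in>UNIV. ?f (a # \<omega>) i) =
     (\<Prod>i\<in>UNIV. (if i = a then x - \<kappa> i - of_nat (count_list \<omega> i) else 1) * ?f \<omega> i)"
    by (intro prod.cong) auto
  also have "\<dots> = (x - \<kappa> a - of_nat (count_list \<omega> a)) * (\<Prod>i\<in>UNIV. ?f \<omega> i)"
    by (simp add: prod.distrib)
  finally have prod: "(\<Prod>i\<in>UNIV. ?f (a # \<omega>) i) =
     (x - \<kappa> a - of_nat (count_list \<omega> a)) * (\<Prod>i\<in>UNIV. ?f \<omega> i)" .
  have "moment_transform b (op_U \<kappa> b (a # \<omega>) P) x = (\<Prod>i\<in>UNIV. ?f \<omega> i) *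
      ((x - \<kappa> a - of_nat (count_list \<omega> a)) * moment_transform b P (x + of_nat (length (a # \<omega>))))"
    using Cons by (simp add: op_U_Cons laurent_vec_op_T moment_transform_op_T[OF _ assms(2)] add_ac)
  then show ?case
    unfolding prod by (simp only: mult_ac)
qed simp

section \<open>Contour integrals against the weights\<close>

lemma weight_eq_kernel:
  "weight \<kappa> b j i z = (\<Sum>k. z powi (- int k - 1) * weight_kernel b j (of_nat k + \<kappa> i))"
  unfolding weight_def weight_kernel_def
  by (simp add: divide_inverse rGamma_inverse_Gamma prod_inversef[symmetric] comp_def inverse_mult_distrib add_ac)

text \<open>With y = k + x, passing from k to k + 1 divides the kernel by (y + b_j + 2) \<Prod>(y +
  b_h + 1). For large k this divisor has modulus at least 2, and the ratio test applies.\<close>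

lemma summable_norm_kernel: "summable (\<lambda>k. norm (weight_kernel b j (of_nat k + x)))"
proof -
  \<comment> \<open>For k at least \<open>C\<close>, the modulus of k + d exceeds that of x + b_h by
    at least 4, which bounds every factor of the divisor from below.\<close>
  define C where "C = norm x + (\<Sum>h\<in>UNIV. norm (b h)) + 4"
  have big: "2 \<le> norm (of_nat k + x + b h + of_nat d)" if "real k \<ge> C" "d \<le> 2" for k h d
  proof -
    have "norm (b h) \<le> (\<Sum>h\<in>UNIV. norm (b h))"
      by (rule member_le_sum) auto
    moreover have "norm (of_nat k + x + b h + of_nat d) \<ge> norm (of_nat (k + d) :: complex) - norm (x + b h)"
      using norm_diff_ineq[of "of_nat (k + d)" "x + b h"] by (simp add: add_ac)
    moreover have "norm (of_nat (k + d) :: complex) \<ge> real k"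
      unfolding norm_of_nat by simp
    moreover have "norm (x + b h) \<le> norm x + norm (b h)"
      by (rule norm_triangle_ineq)
    ultimately show ?thesis using that unfolding C_def by linarith
  qed
  show ?thesis
  proof (rule summable_ratio_test[of "1/2" "nat \<lceil>C\<rceil>"])
    fix k assume "k \<ge> nat \<lceil>C\<rceil>"
    then have k: "real k \<ge> C" by linarith
    let ?y = "of_nat k + x"
    have 1: "rGamma (?y + b j + 2) = (?y + b j + 2) * rGamma (?y + 1 + b j + 2)"
      using rGamma_plus1[of "?y + b j + 2"] by (simp add: add_ac)
    have 2: "rGamma (?y + b h + 1) = (?y + b h + 1) * rGamma (?y + 1 + b h + 1)" for h
      using rGamma_plus1[of "?y + b h + 1"] by (simp add: add_ac)
    have eq: "weight_kernel b j ?y =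
        ((?y + b j + 2) * (\<Prod>h\<in>UNIV - {j}. ?y + b h + 1)) * weight_kernel b j (?y + 1)"
      unfolding weight_kernel_def 1 2 prod.distrib by (simp only: mult_ac)
    have "2 \<le> norm (?y + b j + 2)"
      using big[OF k, of 2 j] by (simp add: add_ac)
    moreover have "1 \<le> norm (\<Prod>h\<in>UNIV - {j}. ?y + b h + 1)"
      unfolding prod_norm[symmetric]
    proof (rule prod_ge_1)
      fix h show "1 \<le> norm (?y + b h + 1)"
        using big[OF k, of 1 h] by (simp add: add_ac)
    qed
    ultimately have "2 * 1 \<le> norm ((?y + b j + 2) * (\<Prod>h\<in>UNIV - {j}. ?y + b h + 1))"
      unfolding norm_mult by (intro mult_mono) auto
    then have "2 * norm (weight_kernel b j (?y + 1)) \<le> norm (weight_kernel b j ?y)"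
      unfolding eq norm_mult by (intro mult_right_mono) auto
    then show "norm (norm (weight_kernel b j (of_nat (Suc k) + x))) \<le> 1/2 * norm (norm (weight_kernel b j ?y))"
      by (simp add: add_ac)
  qed simp
qed

lemma has_contour_integral_power_powi:
  "((\<lambda>z. z ^ a * z powi (- int k - 1)) has_contour_integral (if a = k then 2 * of_real pi * \<i> else 0))
     (circlepath 0 1)"
proof -
  \<comment> \<open>Cauchy's formula for the k-th derivative of w^a at 0, which is k! if a = k and 0
    otherwise.\<close>
  have "((\<lambda>u. u ^ a / (u - 0) ^ Suc k) has_contour_integral
      (2 * pi * \<i>) / fact k * (deriv ^^ k) (\<lambda>w. w ^ a) 0) (circlepath 0 1)"
    by (rule Cauchy_has_contour_integral_higher_derivative_circlepath)
       (auto intro!: continuous_intros holomorphic_intros)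
  moreover have "(deriv ^^ k) (\<lambda>w. w ^ a) (0::complex) = (if a = k then fact k else 0)"
    using higher_deriv_power[of k "0::complex" a 0]
    by (auto simp: pochhammer_0_left pochhammer_fact not_less)
  moreover have "u ^ a / (u - 0) ^ Suc k = u ^ a * u powi (- int k - 1)" for u :: complex
  proof -
    have "u powi (- int (Suc k)) = inverse (u ^ Suc k)"
      by (simp only: power_int_minus power_int_of_nat)
    moreover have "- int (Suc k) = - int k - 1" by simp
    ultimately show ?thesis
      by (simp only: divide_inverse diff_zero)
  qed
  ultimately show ?thesis
    by (auto split: if_splits)
qed

text \<open>On the unit circle the powers of z have modulus 1, so the kernel norms are a summable
  majorant and the series may be integrated term by term.\<close>

lemma has_contour_integral_weight:
  "((\<lambda>z. z ^ a * weight \<kappa> b j i z) has_contour_integral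
      (2 * of_real pi * \<i> * weight_kernel b j (of_nat a + \<kappa> i))) (circlepath 0 1)"
proof -
  let ?c = "\<lambda>k. weight_kernel b j (of_nat k + \<kappa> i)"
  let ?f = "\<lambda>n z. \<Sum>k<n. z ^ a * z powi (- int k - 1) * ?c k"
  have int: "(?f n has_contour_integral
      (\<Sum>k<n. (if a = k then 2 * of_real pi * \<i> else 0) * ?c k)) (circlepath 0 1)" for n
    by (intro has_contour_integral_sum has_contour_integral_rmul has_contour_integral_power_powi) auto
  have lim: "uniform_limit (sphere 0 1) ?f (\<lambda>z. \<Sum>k. z ^ a * z powi (- int k - 1) * ?c k) sequentially"
    by (rule Weierstrass_m_test[OF _ summable_norm_kernel])
       (auto simp: norm_mult norm_power norm_power_int)
  have lim': "uniform_limit (sphere 0 1) ?f (\<lambda>z. z ^ a * weight \<kappa> b j i z) sequentially"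
  proof (rule uniform_limit_cong'[THEN iffD1, OF _ _ lim])
    fix z :: complex assume "z \<in> sphere 0 1"
    then have "summable (\<lambda>k. z powi (- int k - 1) * ?c k)"
      by (intro summable_comparison_test'[OF summable_norm_kernel])
         (auto simp: norm_mult norm_power_int)
    then show "(\<Sum>k. z ^ a * z powi (- int k - 1) * ?c k) = z ^ a * weight \<kappa> b j i z"
      unfolding weight_eq_kernel by (simp add: suminf_mult mult.assoc)
  qed auto
  have ev: "\<forall>\<^sub>F n in sequentially. ?f n contour_integrable_on (circlepath 0 1)"
    unfolding contour_integrable_on_def using int by (intro always_eventually allI exI)
  note * = contour_integral_uniform_limit_circlepath[OF ev lim']
  \<comment> \<open>Only the term k = a has a nonzero integral, so the integrals of the partial sums
    are constant from n = a + 1 on.\<close>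
  have "(\<lambda>n. contour_integral (circlepath 0 1) (?f n)) \<longlonglongrightarrow> 2 * of_real pi * \<i> * ?c a"
  proof (rule tendsto_eventually, rule eventually_sequentiallyI[of "Suc a"])
    fix n assume "Suc a \<le> n"
    then have "(\<Sum>k<n. (if a = k then 2 * of_real pi * \<i> else 0) * ?c k) = 2 * of_real pi * \<i> * ?c a"
      by (simp add: if_distrib[of "\<lambda>x. x * _"] cong: if_cong)
    then show "contour_integral (circlepath 0 1) (?f n) = 2 * of_real pi * \<i> * ?c a"
      using contour_integral_unique[OF int[of n]] by simp
  qed
  then have "contour_integral (circlepath 0 1) (\<lambda>z. z ^ a * weight \<kappa> b j i z) = 2 * of_real pi * \<i> * ?c a"
    using *(2) by (intro LIMSEQ_unique[rotated]) auto
  then show ?thesis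
    using *(1) has_contour_integral_integral by fastforce
qed

section \<open>Polynomial vectors and their orthogonality relations\<close>

definition fls_vec :: "('q \<Rightarrow> complex poly) \<Rightarrow> 'q \<Rightarrow> complex fls" where
  "fls_vec B = (\<lambda>j. fps_to_fls (fps_of_poly (B j)))"

lemma fls_vec_nth: "fls_nth (fls_vec B j) t = (if t < 0 then 0 else coeff (B j) (nat t))"
  by (simp add: fls_vec_def)

lemma moment_transform_fls_vec:
  assumes "\<And>j t. t \<ge> M j \<Longrightarrow> coeff (B j) t = 0"
  shows "moment_transform b (fls_vec B) x = (\<Sum>j\<in>UNIV. \<Sum>t<M j. coeff (B j) t * weight_kernel b j (x + of_nat t))"
  unfolding moment_transform_def
proof (rule sum.cong[OF refl])
  fix j
  have "(\<Sum>t | fls_nth (fls_vec B j) t \<noteq> 0. fls_nth (fls_vec B j) t * weight_kernel b j (x + of_int t))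
     = (\<Sum>t\<in>int ` {..<M j}. fls_nth (fls_vec B j) t * weight_kernel b j (x + of_int t))"
  proof (rule sum.mono_neutral_left)
    show "{t. fls_nth (fls_vec B j) t \<noteq> 0} \<subseteq> int ` {..<M j}"
    proof
      fix t assume "t \<in> {t. fls_nth (fls_vec B j) t \<noteq> 0}"
      then have "t \<ge> 0" "coeff (B j) (nat t) \<noteq> 0"
        by (auto simp: fls_vec_nth split: if_splits)
      moreover from this have "nat t < M j"
        using assms[of j "nat t"] by (meson not_le)
      ultimately show "t \<in> int ` {..<M j}"
        by (intro image_eqI[of _ _ "nat t"]) auto
    qed
  qed auto
  also have "\<dots> = (\<Sum>t<M j. coeff (B j) t * weight_kernel b j (x + of_nat t))"
    by (simp add: sum.reindex fls_vec_nth)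
  finally show "(\<Sum>t | fls_nth (fls_vec B j) t \<noteq> 0. fls_nth (fls_vec B j) t * weight_kernel b j (x + of_int t))
     = (\<Sum>t<M j. coeff (B j) t * weight_kernel b j (x + of_nat t))" .
qed

lemma laurent_vec_fls_vec: "laurent_vec (fls_vec B)"
  unfolding laurent_vec_def
proof
  fix j
  have "{t. fls_nth (fls_vec B j) t \<noteq> 0} \<subseteq> int ` {..degree (B j)}"
  proof
    fix t assume "t \<in> {t. fls_nth (fls_vec B j) t \<noteq> 0}"
    then show "t \<in> int ` {..degree (B j)}"
      by (intro image_eqI[of _ _ "nat t"]) (auto simp: fls_vec_nth le_degree split: if_splits)
  qed
  then show "finite {t. fls_nth (fls_vec B j) t \<noteq> 0}"
    by (rule finite_subset) simp
qed

text \<open>The monomial z^(l+t) picks out the weight coefficient of index l + t. Orthogonality thus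
  becomes vanishing of the transform at the points \<kappa>_i + l.\<close>

lemma contour_integral_eq_moment_transform:
  "(\<Sum>j\<in>UNIV. contour_integral (circlepath 0 1)
      (\<lambda>z. z ^ l * poly (B j) z * weight \<kappa> b j i z / (2 * of_real pi * \<i>)))
   = moment_transform b (fls_vec B) (\<kappa> i + of_nat l)"
proof -
  have "contour_integral (circlepath 0 1)
      (\<lambda>z. z ^ l * poly (B j) z * weight \<kappa> b j i z / (2 * of_real pi * \<i>)) =
     (\<Sum>t<Suc (degree (B j)). coeff (B j) t * weight_kernel b j (\<kappa> i + of_nat l + of_nat t))" for j
  proof -
    have "((\<lambda>z. \<Sum>t<Suc (degree (B j)). coeff (B j) t / (2 * of_real pi * \<i>) *
          (z ^ (l + t) * weight \<kappa> b j i z)) has_contour_integral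
       (\<Sum>t<Suc (degree (B j)). coeff (B j) t / (2 * of_real pi * \<i>) *
          (2 * of_real pi * \<i> * weight_kernel b j (of_nat (l + t) + \<kappa> i)))) (circlepath 0 1)"
      by (intro has_contour_integral_sum has_contour_integral_lmul has_contour_integral_weight) auto
    also have "(\<lambda>z. \<Sum>t<Suc (degree (B j)). coeff (B j) t / (2 * of_real pi * \<i>) *
          (z ^ (l + t) * weight \<kappa> b j i z)) =
       (\<lambda>z. z ^ l * poly (B j) z * weight \<kappa> b j i z / (2 * of_real pi * \<i>))"
      unfolding poly_altdef lessThan_Suc_atMost sum_distrib_left sum_distrib_right sum_divide_distrib
      by (simp add: power_add mult_ac)
    also have "(\<Sum>t<Suc (degree (B j)). coeff (B j) t / (2 * of_real pi * \<i>) *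
          (2 * of_real pi * \<i> * weight_kernel b j (of_nat (l + t) + \<kappa> i))) =
       (\<Sum>t<Suc (degree (B j)). coeff (B j) t * weight_kernel b j (\<kappa> i + of_nat l + of_nat t))"
    proof (rule sum.cong[OF refl])
      fix t
      have "c / w * (w * k) = c * k" if "w \<noteq> 0" for c w k :: complex
        using that by simp
      from this[of "2 * of_real pi * \<i>"]
      show "coeff (B j) t / (2 * of_real pi * \<i>) *
          (2 * of_real pi * \<i> * weight_kernel b j (of_nat (l + t) + \<kappa> i)) =
          coeff (B j) t * weight_kernel b j (\<kappa> i + of_nat l + of_nat t)"
        by (simp only: of_nat_add add_ac) simp
    qed
    finally show ?thesis
      by (rule contour_integral_unique)
  qed
  then show ?thesis
    by (subst moment_transform_fls_vec[where M = "\<lambda>j. Suc (degree (B j))"])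
       (auto simp: coeff_eq_0 simp del: sum.lessThan_Suc)
qed

section \<open>Injectivity of the moment transform\<close>

lemma moment_transform_top_coeff:
  assumes "\<And>l t. t > T \<Longrightarrow> fls_nth (P l) t = 0" "laurent_vec P"
  shows "moment_transform b P (- of_int T - b j - 1) =
    fls_nth (P j) T * (\<Prod>h\<in>UNIV - {j}. rGamma (b h - b j))"
proof -
  from assms(2) obtain S where S: "finite S" "\<And>j t. t \<notin> S \<Longrightarrow> fls_nth (P j) t = 0"
    using laurent_vecE by blast
  let ?x = "- of_int T - b j - 1"
  \<comment> \<open>For l other than j and t at most T, the kernel of l contains rGamma(t - T) = 0.
    For l = j the corresponding factor is rGamma(t - T + 1), which vanishes only for t < T; at t = T
    it equals 1. This offset is what isolates the top coefficient of component j.\<close>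
  have 0: "fls_nth (P l) t * weight_kernel b l (?x + of_int t) = 0" if "(l, t) \<noteq> (j, T)" for l t
  proof (cases "t > T")
    case False
    then have nonpos: "of_int t - of_int T \<in> (\<int>\<^sub>\<le>\<^sub>0 :: complex set)"
      by (metis of_int_diff nonpos_Ints_of_int diff_le_0_iff_le not_le)
    have "weight_kernel b l (?x + of_int t) = 0"
    proof (cases "l = j")
      case True
      with that False have "t + 1 - T \<le> 0" by auto
      then have "of_int (t + 1 - T) \<in> (\<int>\<^sub>\<le>\<^sub>0 :: complex set)"
        by (rule nonpos_Ints_of_int)
      then have "rGamma (of_int t - of_int T + 1 :: complex) = 0"
        by (simp add: rGamma_eq_zero_iff algebra_simps)
      then show ?thesis
        by (simp add: weight_kernel_def True algebra_simps)
    next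
      case False
      with nonpos show ?thesis
        by (auto simp: weight_kernel_def rGamma_eq_zero_iff intro!: bexI[of _ j])
    qed
    then show ?thesis by simp
  qed (simp add: assms)
  have "moment_transform b P ?x =
     (\<Sum>l\<in>UNIV. \<Sum>t\<in>insert T S. fls_nth (P l) t * weight_kernel b l (?x + of_int t))"
    by (rule moment_transform_eq_sum) (use S in auto)
  also have "\<dots> = (\<Sum>(l, t)\<in>UNIV \<times> insert T S. fls_nth (P l) t * weight_kernel b l (?x + of_int t))"
    by (rule sum.cartesian_product)
  also have "\<dots> = (\<Sum>(l, t)\<in>{(j, T)}. fls_nth (P l) t * weight_kernel b l (?x + of_int t))"
    by (intro sum.mono_neutral_right ballI)
       (use S(1) 0 in \<open>auto split: prod.splits simp del: mult_eq_0_iff\<close>)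
  also have "\<dots> = fls_nth (P j) T * (\<Prod>h\<in>UNIV - {j}. rGamma (b h - b j))"
    by (simp add: weight_kernel_def)
  finally show ?thesis .
qed

text \<open>If P - c Q were nonzero, some component would have a nonzero coefficient at the largest
  exponent occurring in any component. The reciprocal Gamma values multiplying it are nonzero
  because the b_j do not differ by integers, contradicting the vanishing of the transform.\<close>

lemma moment_transform_inject:
  assumes "laurent_vec P" "laurent_vec Q" "\<And>x. moment_transform b P x = c * moment_transform b Q x"
    and b: "\<And>j h. j \<noteq> h \<Longrightarrow> b j - b h \<notin> \<int>"
  shows "P j = fls_const c * Q j"
proof -
  define R where "R = (\<lambda>j. P j - fls_const c * Q j)"
  from assms(1) obtain S1 where S1: "finite S1" "\<And>j t. t \<notin> S1 \<Longrightarrow> fls_nth (P j) t = 0"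
    using laurent_vecE by blast
  from assms(2) obtain S2 where S2: "finite S2" "\<And>j t. t \<notin> S2 \<Longrightarrow> fls_nth (Q j) t = 0"
    using laurent_vecE by blast
  define S where "S = S1 \<union> S2"
  have S: "finite S" "\<And>j t. t \<notin> S \<Longrightarrow> fls_nth (P j) t = 0" "\<And>j t. t \<notin> S \<Longrightarrow> fls_nth (Q j) t = 0"
    "\<And>j t. t \<notin> S \<Longrightarrow> fls_nth (R j) t = 0"
    using S1 S2 by (auto simp: S_def R_def)
  have "laurent_vec R" using S by (intro laurent_vecI[of S]) auto
  have "moment_transform b R x = moment_transform b P x - c * moment_transform b Q x" for x
    using S by (simp add: moment_transform_eq_sum[of S] R_def sum_distrib_left sum_subtractf algebra_simps)
  then have R0: "moment_transform b R x = 0" for x using assms(3) by simp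
  define E where "E = {t. \<exists>j. fls_nth (R j) t \<noteq> 0}"
  have "finite E" by (rule finite_subset[OF _ S(1)]) (use S(4) in \<open>auto simp: E_def\<close>)
  have "E = {}"
  proof (rule ccontr)
    assume "E \<noteq> {}"
    with \<open>finite E\<close> have "Max E \<in> E" by simp
    then obtain j where j: "fls_nth (R j) (Max E) \<noteq> 0" by (auto simp: E_def)
    have "fls_nth (R l) t = 0" if "t > Max E" for l t
      using Max_ge[OF \<open>finite E\<close>, of t] that by (auto simp: E_def)
    from moment_transform_top_coeff[OF this \<open>laurent_vec R\<close>, where b = b and j = j] R0 j
    obtain h where "h \<noteq> j" "b h - b j \<in> \<int>\<^sub>\<le>\<^sub>0"
      by (auto simp: rGamma_eq_zero_iff)
    with b show False using nonpos_Ints_subset_Ints by blast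
  qed
  then have "R j = 0" by (intro fls_eqI) (auto simp: E_def)
  then show ?thesis by (simp add: R_def)
qed

section \<open>Polynomial numerators over a common denominator\<close>

lemma poly_pochhammer_linear:
  "poly (pochhammer [:a, 1:] n) x = pochhammer (x + a) n"
  by (induction n) (simp_all add: pochhammer_Suc algebra_simps)

lemma degree_pochhammer_linear: "degree (pochhammer [:a::complex, 1:] n) \<le> n"
proof (induction n)
  case (Suc n)
  have "degree (pochhammer [:a, 1:] (Suc n)) \<le> degree (pochhammer [:a, 1:] n) + degree ([:a, 1:] + of_nat n)"
    unfolding pochhammer_Suc by (rule degree_mult_le)
  also have "degree ([:a, 1:] + of_nat n) \<le> 1"
    by (simp add: of_nat_poly)
  finally show ?case using Suc by simp
qed simp

text \<open>Near the diagonal, t < m_j forces t \<le> m_h for all h, so each reciprocal Gamma factor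
  can be moved up to the common one at the cost of a Pochhammer polynomial.\<close>

lemma weight_kernel_eq_poly:
  fixes m :: "'q::finite \<Rightarrow> nat"
  assumes "near_diagonal m" "t < m j"
  shows "\<exists>Q. degree Q < (\<Sum>h\<in>UNIV. m h) \<and>
     (\<forall>x. weight_kernel b j (x + of_nat t) = poly Q x * (\<Prod>h\<in>UNIV. rGamma (x + of_nat (m h) + b h + 1)))"
proof -
  have le: "t \<le> m h" for h
  proof -
    have "\<bar>int (m j) - int (m h)\<bar> \<le> 1"
      using assms(1) unfolding near_diagonal_def by blast
    with assms(2) show ?thesis by linarith
  qed
  \<comment> \<open>\<open>e h\<close> is the offset of the factor h in the shifted kernel. The
    extra 1 at j comes from the summand 2 in \<open>weight_kernel\<close> and makes the degree bound
    strict.\<close>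
  define e where "e = (\<lambda>h. if h = j then t + 1 else t)"
  have e: "e h \<le> m h" for h using le assms by (auto simp: e_def)
  define Q where "Q = (\<Prod>h\<in>UNIV. pochhammer [:of_nat (e h) + b h + 1, 1:] (m h - e h))"
  have "degree Q \<le> sum (degree \<circ> (\<lambda>h. pochhammer [:of_nat (e h) + b h + 1, 1:] (m h - e h))) UNIV"
    unfolding Q_def by (rule degree_prod_sum_le) simp
  also have "\<dots> \<le> (\<Sum>h\<in>UNIV. m h - e h)"
    by (intro sum_mono) (simp add: degree_pochhammer_linear)
  also have "\<dots> < (\<Sum>h\<in>UNIV. m h)"
    by (rule sum_strict_mono_ex1) (use assms in \<open>auto simp: e_def intro!: exI[of _ j]\<close>)
  finally have deg: "degree Q < (\<Sum>h\<in>UNIV. m h)" .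
  have "weight_kernel b j (x + of_nat t) = poly Q x * (\<Prod>h\<in>UNIV. rGamma (x + of_nat (m h) + b h + 1))" for x
  proof -
    have "weight_kernel b j (x + of_nat t) = (\<Prod>h\<in>UNIV. rGamma (x + of_nat (e h) + b h + 1))"
      unfolding weight_kernel_def by (subst prod.remove[of UNIV j]) (auto simp: e_def add_ac)
    also have "\<dots> = (\<Prod>h\<in>UNIV. pochhammer (x + of_nat (e h) + b h + 1) (m h - e h) *
        rGamma (x + of_nat (m h) + b h + 1))"
    proof (rule prod.cong[OF refl])
      fix h
      show "rGamma (x + of_nat (e h) + b h + 1) =
          pochhammer (x + of_nat (e h) + b h + 1) (m h - e h) * rGamma (x + of_nat (m h) + b h + 1)"
        by (subst pochhammer_rGamma[of _ "m h - e h"]) (simp add: of_nat_diff e add_ac)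
    qed
    finally show ?thesis
      by (simp add: Q_def poly_prod poly_pochhammer_linear prod.distrib add_ac)
  qed
  with deg show ?thesis by blast
qed

lemma moment_transform_eq_poly:
  fixes m :: "'q::finite \<Rightarrow> nat"
  assumes "near_diagonal m" "\<And>j t. t \<ge> m j \<Longrightarrow> coeff (B j) t = 0" "0 < (\<Sum>h\<in>UNIV. m h)"
  obtains Q where "degree Q < (\<Sum>h\<in>UNIV. m h)"
    "\<And>x. moment_transform b (fls_vec B) x = poly Q x * (\<Prod>h\<in>UNIV. rGamma (x + of_nat (m h) + b h + 1))"
proof -
  let ?P = "\<lambda>j t Q. t < m j \<longrightarrow> degree Q < (\<Sum>h\<in>UNIV. m h) \<and>
     (\<forall>x. weight_kernel b j (x + of_nat t) = poly Q x * (\<Prod>h\<in>UNIV. rGamma (x + of_nat (m h) + b h + 1)))"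
  have "\<forall>j t. \<exists>Q. ?P j t Q"
    using weight_kernel_eq_poly[OF assms(1)] by blast
  then have "\<exists>Q. \<forall>j t. ?P j t (Q j t)"
    by (simp only: choice_iff)
  then obtain Q where Q: "\<And>j t. t < m j \<Longrightarrow> degree (Q j t) < (\<Sum>h\<in>UNIV. m h)"
    "\<And>j t x. t < m j \<Longrightarrow>
      weight_kernel b j (x + of_nat t) = poly (Q j t) x * (\<Prod>h\<in>UNIV. rGamma (x + of_nat (m h) + b h + 1))"
    by blast
  show thesis
  proof
    show "degree (\<Sum>j\<in>UNIV. \<Sum>t<m j. smult (coeff (B j) t) (Q j t)) < (\<Sum>h\<in>UNIV. m h)"
      using assms(3) by (intro degree_sum_less) (auto intro: le_less_trans[OF degree_smult_le] Q(1))
    show "moment_transform b (fls_vec B) x = poly (\<Sum>j\<in>UNIV. \<Sum>t<m j. smult (coeff (B j) t) (Q j t)) x *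
        (\<Prod>h\<in>UNIV. rGamma (x + of_nat (m h) + b h + 1))" for x
      by (subst moment_transform_fls_vec[OF assms(2)])
         (auto simp: poly_sum sum_distrib_right Q(2) mult.assoc intro!: sum.cong)
  qed
qed

section \<open>Existence of B-vectors by counting\<close>

lemma homogeneous_system_nontrivial:
  fixes M :: "'e \<Rightarrow> 'a \<Rightarrow> 'k::field"
  assumes "finite E" "finite A" "card E < card A"
  shows "\<exists>x. (\<exists>a\<in>A. x a \<noteq> 0) \<and> (\<forall>e\<in>E. (\<Sum>a\<in>A. M e a * x a) = 0)"
  using assms
proof (induction E arbitrary: A M rule: finite_induct)
  case empty
  then show ?case by (intro exI[of _ "\<lambda>_. 1"]) (auto simp: card_gt_0_iff)
next
  case (insert e E)
  show ?case
  proof (cases "\<forall>a\<in>A. M e a = 0")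
    case True
    from insert have "card E < card A" by simp
    from insert.IH[OF insert.prems(1) this, of M] True show ?thesis by auto
  next
    case False
    then obtain a0 where a0: "a0 \<in> A" "M e a0 \<noteq> 0" by auto
    define A' where "A' = A - {a0}"
    have A: "A = insert a0 A'" "finite A'" "a0 \<notin> A'"
      using a0 insert.prems by (auto simp: A'_def)
    have "card E < card A'"
      using insert.prems insert.hyps A by simp
    \<comment> \<open>Gaussian elimination: the pivot \<open>M e a0\<close> removes the unknown
      \<open>a0\<close> from the other equations, and afterwards the equation \<open>e\<close>
      determines its value.\<close>
    from insert.IH[OF A(2) this, of "\<lambda>f a. M f a - M f a0 * M e a / M e a0"]
    obtain x where x: "\<exists>a\<in>A'. x a \<noteq> 0"
      "\<And>f. f \<in> E \<Longrightarrow> (\<Sum>a\<in>A'. (M f a - M f a0 * M e a / M e a0) * x a) = 0" by blast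
    define y where "y = x(a0 := - (\<Sum>a\<in>A'. M e a * x a) / M e a0)"
    have y: "(\<Sum>a\<in>A. M f a * y a) =
        (\<Sum>a\<in>A'. M f a * x a) - M f a0 * (\<Sum>a\<in>A'. M e a * x a) / M e a0" for f
    proof -
      have "(\<Sum>a\<in>A'. M f a * y a) = (\<Sum>a\<in>A'. M f a * x a)"
        using A(3) by (intro sum.cong) (auto simp: y_def)
      then show ?thesis using A by (simp add: y_def)
    qed
    have "(\<Sum>a\<in>A. M f a * y a) = 0" if "f \<in> insert e E" for f
    proof (cases "f = e")
      case False
      then have "f \<in> E" using that by simp
      with x(2)[of f] show ?thesis
        by (simp add: y left_diff_distrib sum_subtractf sum_distrib_left sum_divide_distrib mult.assoc)
    qed (use a0 y in simp)
    moreover have "\<exists>a\<in>A. y a \<noteq> 0"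
      using x(1) A by (auto simp: y_def)
    ultimately show ?thesis by blast
  qed
qed

lemma polys_le_iff: "P \<in> polys_le (int m - 1) \<longleftrightarrow> (\<forall>t\<ge>m. coeff P t = 0)"
proof
  assume "P \<in> polys_le (int m - 1)"
  then show "\<forall>t\<ge>m. coeff P t = 0"
    by (cases "P = 0") (auto simp: polys_le_def intro!: coeff_eq_0)
next
  assume *: "\<forall>t\<ge>m. coeff P t = 0"
  have "degree P < m" if "P \<noteq> 0"
    using * that leading_coeff_neq_0 by (metis not_le)
  then show "P \<in> polys_le (int m - 1)"
    by (auto simp: polys_le_def)
qed

lemma is_B_vector_iff:
  "is_B_vector \<kappa> b n m B \<longleftrightarrow>
     (\<exists>j. B j \<noteq> 0) \<and> (\<forall>j. \<forall>t\<ge>m j. coeff (B j) t = 0) \<and>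
     (\<forall>i. \<forall>l<n i. moment_transform b (fls_vec B) (\<kappa> i + of_nat l) = 0)"
  unfolding is_B_vector_def polys_le_iff contour_integral_eq_moment_transform ..

lemma is_B_vector_smult:
  assumes "is_B_vector \<kappa> b n m B" "c \<noteq> 0"
  shows "is_B_vector \<kappa> b n m (\<lambda>j. smult c (B j))"
proof -
  have "moment_transform b (fls_vec (\<lambda>j. smult c (B j))) x = c * moment_transform b (fls_vec B) x" for x
    using assms(1)
    by (simp add: is_B_vector_iff moment_transform_fls_vec[where M = m] sum_distrib_left mult.assoc)
  with assms show ?thesis
    by (auto simp: is_B_vector_iff)
qed

lemma exists_B_vector:
  fixes n :: "'p::finite \<Rightarrow> nat" and m :: "'q::finite \<Rightarrow> nat"
  assumes "(\<Sum>i\<in>UNIV. n i) < (\<Sum>j\<in>UNIV. m j)"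
  shows "\<exists>B. is_B_vector \<kappa> b n m B"
proof -
  \<comment> \<open>\<open>?A\<close> indexes the unknown coefficients and \<open>?E\<close> the
    orthogonality conditions.\<close>
  let ?A = "SIGMA j:UNIV. {..<m j}" and ?E = "SIGMA i:UNIV. {..<n i}"
  have "card ?E < card ?A" using assms by simp
  from homogeneous_system_nontrivial[OF _ _ this,
      of "\<lambda>(i, l) (j, t). weight_kernel b j (\<kappa> i + of_nat l + of_nat t)"]
  obtain c where c: "\<exists>a\<in>?A. c a \<noteq> 0"
    "\<And>e. e \<in> ?E \<Longrightarrow>
      (\<Sum>a\<in>?A. (case e of (i, l) \<Rightarrow> \<lambda>(j, t). weight_kernel b j (\<kappa> i + of_nat l + of_nat t)) a * c a) = 0"
    by auto
  define B where "B = (\<lambda>j. \<Sum>t<m j. monom (c (j, t)) t)"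
  have B: "coeff (B j) t = (if t < m j then c (j, t) else 0)" for j t
    by (simp add: B_def coeff_sum)
  have "moment_transform b (fls_vec B) (\<kappa> i + of_nat l) = 0" if "l < n i" for i l
  proof -
    have "moment_transform b (fls_vec B) (\<kappa> i + of_nat l) =
        (\<Sum>j\<in>UNIV. \<Sum>t<m j. weight_kernel b j (\<kappa> i + of_nat l + of_nat t) * c (j, t))"
      by (subst moment_transform_fls_vec[where M = m]) (auto simp: B mult.commute intro!: sum.cong)
    also have "\<dots> = (\<Sum>(j, t)\<in>?A. weight_kernel b j (\<kappa> i + of_nat l + of_nat t) * c (j, t))"
      by (rule sum.Sigma) auto
    also have "\<dots> = 0"
      using c(2)[of "(i, l)"] that by (simp add: case_prod_beta)
    finally show ?thesis .
  qed
  moreover from c(1) obtain j t where "t < m j" "c (j, t) \<noteq> 0" by auto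
  then have "B j \<noteq> 0" using B[of j t] by auto
  ultimately have "is_B_vector \<kappa> b n m B"
    by (auto simp: is_B_vector_iff B)
  then show ?thesis by blast
qed

section \<open>Transforms of the initial monomial and of B-vectors\<close>

lemma near_diagonal_cases:
  assumes "near_diagonal m"
  shows "h \<in> Hset m \<Longrightarrow> m h = mstar m" "h \<notin> Hset m \<Longrightarrow> Suc (m h) = mstar m"
proof -
  have le: "m h \<le> mstar m" by (simp add: mstar_def)
  have "mstar m \<in> range m" unfolding mstar_def by (rule Max_in) auto
  then obtain k where "m k = mstar m" by auto
  moreover have "\<bar>int (m k) - int (m h)\<bar> \<le> 1"
    using assms unfolding near_diagonal_def by blast
  ultimately show "h \<notin> Hset m \<Longrightarrow> Suc (m h) = mstar m"
    using le by (auto simp: Hset_def)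
qed (simp add: Hset_def)

lemma Hset_nonempty: "Hset m \<noteq> {}"
proof -
  have "mstar m \<in> range m" unfolding mstar_def by (rule Max_in) auto
  then show ?thesis by (auto simp: Hset_def)
qed

lemma laurent_monom_nth: "fls_nth (laurent_monom e v j) t = (if t = e then v j else 0)"
  by (simp add: laurent_monom_def)

lemma laurent_vec_laurent_monom: "laurent_vec (laurent_monom e v)"
  by (rule laurent_vecI[of "{e}"]) (simp_all add: laurent_monom_nth)

text \<open>The exponent moves the kernel argument to x + \<open>mstar m\<close> - 1. Partial
  fractions over \<open>Hset m\<close> then add 2 on \<open>Hset m\<close> and 1 off it; since m_h
  is \<open>mstar m\<close> or one less, the offset is m_h + 1 in both cases.\<close>

lemma moment_transform_laurent_monom_vH:
  assumes "near_diagonal m" "inj b"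
  shows "moment_transform b (laurent_monom (int (mstar m) - 1 - int N) (vH b m)) (x + of_nat N) =
    (\<Prod>h\<in>UNIV. rGamma (x + of_nat (m h) + b h + 1))"
proof -
  let ?e = "int (mstar m) - 1 - int N"
  have "moment_transform b (laurent_monom ?e (vH b m)) (x + of_nat N) =
      (\<Sum>j\<in>UNIV. vH b m j * weight_kernel b j (x + of_nat (mstar m) - 1))"
    by (subst moment_transform_eq_sum[of "{?e}"]) (simp_all add: laurent_monom_nth algebra_simps)
  also have "\<dots> = (\<Sum>j\<in>Hset m. (\<Prod>l\<in>Hset m - {j}. inverse (b l - b j)) *
      weight_kernel b j (x + of_nat (mstar m) - 1))"
    by (rule sum.mono_neutral_cong_right) (auto simp: vH_def)
  also have "\<dots> = (\<Prod>h\<in>UNIV. rGamma (x + of_nat (mstar m) - 1 + b h + (if h \<in> Hset m then 2 else 1)))"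
    by (rule sum_lagrange_weight_kernel[OF assms(2) Hset_nonempty])
  also have "\<dots> = (\<Prod>h\<in>UNIV. rGamma (x + of_nat (m h) + b h + 1))"
  proof (rule prod.cong[OF refl])
    fix h
    show "rGamma (x + of_nat (mstar m) - 1 + b h + (if h \<in> Hset m then 2 else 1)) =
        rGamma (x + of_nat (m h) + b h + 1)"
    proof (cases "h \<in> Hset m")
      case False
      then have "mstar m = Suc (m h)"
        using near_diagonal_cases(2)[OF assms(1)] by simp
      with False show ?thesis by simp
    qed (simp add: near_diagonal_cases(1)[OF assms(1)] algebra_simps)
  qed
  finally show ?thesis .
qed

text \<open>Regularity makes the points \<kappa>_i + l distinct. Admissibility keeps the denominator
  factor \<open>W\<close> nonzero there, so the zeros of the transform are zeros of the numerator
  \<open>Q\<close>.\<close>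

lemma moment_transform_B_vector:
  fixes \<kappa> :: "'p::finite \<Rightarrow> complex" and b :: "'q::finite \<Rightarrow> complex"
  assumes "regular \<kappa> b" "admissible \<kappa> b" "near_diagonal m"
    and sum: "(\<Sum>j\<in>UNIV. m j) = (\<Sum>i\<in>UNIV. n i) + 1"
    and B: "is_B_vector \<kappa> b n m B"
  obtains c where "\<And>x. moment_transform b (fls_vec B) x = c *
    ((\<Prod>i\<in>UNIV. \<Prod>l<n i. x - \<kappa> i - of_nat l) * (\<Prod>h\<in>UNIV. rGamma (x + of_nat (m h) + b h + 1)))"
proof -
  define W where "W = (\<lambda>x. \<Prod>h\<in>UNIV. rGamma (x + of_nat (m h) + b h + 1))"
  have "\<And>j t. t \<ge> m j \<Longrightarrow> coeff (B j) t = 0" "0 < (\<Sum>h\<in>UNIV. m h)"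
    using B sum by (simp_all add: is_B_vector_iff)
  then obtain Q where Q: "degree Q < (\<Sum>h\<in>UNIV. m h)"
    "\<And>x. moment_transform b (fls_vec B) x = poly Q x * W x"
    using moment_transform_eq_poly[OF assms(3), of B b] unfolding W_def by blast
  define E where "E = (SIGMA i:UNIV. {..<n i})"
  define node where "node = (\<lambda>(i, l). \<kappa> i + of_nat l)"
  have inj: "inj_on node E"
  proof (rule inj_onI, clarify)
    fix i l i' l' assume eq: "node (i, l) = node (i', l')"
    then have "\<kappa> i - \<kappa> i' = of_int (int l' - int l)"
      by (simp add: node_def algebra_simps)
    then have "\<kappa> i - \<kappa> i' \<in> \<int>" by (metis Ints_of_int)
    then have "i = i'" using assms(1) by (auto simp: regular_def)
    with eq show "i = i' \<and> l = l'" by (simp add: node_def)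
  qed
  have fin: "finite E" by (simp add: E_def)
  have card: "card (node ` E) = (\<Sum>i\<in>UNIV. n i)"
    by (subst card_image[OF inj]) (simp add: E_def)
  define P where "P = (\<Prod>e\<in>E. [:- node e, 1:])"
  have P: "poly P x = (\<Prod>e\<in>E. x - node e)" for x
    by (simp add: P_def poly_prod)
  have prod: "poly P x = (\<Prod>i\<in>UNIV. \<Prod>l<n i. x - \<kappa> i - of_nat l)" for x
    unfolding P E_def by (subst prod.Sigma) (auto simp: node_def algebra_simps intro!: prod.cong)
  have Q0: "poly Q x = 0" if x: "x \<in> node ` E" for x
  proof -
    from x obtain i l where x: "l < n i" "x = \<kappa> i + of_nat l" by (auto simp: E_def node_def)
    have "rGamma (x + of_nat (m h) + b h + 1) \<noteq> 0" for h
    proof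
      assume "rGamma (x + of_nat (m h) + b h + 1) = 0"
      then have "\<kappa> i + b h + 1 + of_nat (l + m h) \<in> \<int>\<^sub>\<le>\<^sub>0"
        by (simp add: rGamma_eq_zero_iff x algebra_simps)
      then have "\<kappa> i + b h + 1 \<in> \<int>\<^sub>\<le>\<^sub>0"
        using nonpos_Ints_diff_Nats[of "\<kappa> i + b h + 1 + of_nat (l + m h)" "of_nat (l + m h)"] by simp
      with assms(2) show False by (auto simp: admissible_def)
    qed
    then have "W x \<noteq> 0" by (simp add: W_def)
    moreover have "moment_transform b (fls_vec B) x = 0"
      using B x by (auto simp: is_B_vector_iff)
    ultimately show ?thesis by (simp add: Q)
  qed
  \<comment> \<open>Degrees up to |n| require agreement at |n| + 1 points; one further point
    supplies the last one and fixes the constant.\<close>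
  obtain x0 where x0: "x0 \<notin> node ` E"
    using ex_new_if_finite[OF infinite_UNIV_char_0, of "node ` E"] fin by blast
  then have Px0: "poly P x0 \<noteq> 0" using fin by (auto simp: P)
  define c where "c = poly Q x0 / poly P x0"
  have "Q = smult c P"
  proof (rule poly_eqI_degree[of "insert x0 (node ` E)"])
    fix x assume "x \<in> insert x0 (node ` E)"
    then show "poly Q x = poly (smult c P) x"
      using Px0 Q0 fin by (auto simp: c_def P)
  next
    show "degree Q < card (insert x0 (node ` E))"
      using Q(1) x0 fin sum by (simp add: card)
    have "degree (smult c P) \<le> degree P" by (rule degree_smult_le)
    also have "\<dots> \<le> sum (degree \<circ> (\<lambda>e. [:- node e, 1:])) E"
      unfolding P_def by (rule degree_prod_sum_le[OF fin])
    also have "\<dots> = (\<Sum>i\<in>UNIV. n i)" by (simp add: E_def)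
    also have "\<dots> < card (insert x0 (node ` E))"
      using x0 fin by (simp add: card)
    finally show "degree (smult c P) < card (insert x0 (node ` E))" .
  qed
  then show thesis
    by (intro that[of c]) (simp add: Q prod W_def mult.assoc)
qed

section \<open>Proportionality and normalization\<close>

theorem theorem5p4:
  fixes \<kappa> :: "'p::finite \<Rightarrow> complex" and b :: "'q::finite \<Rightarrow> complex"
    and n :: "'p \<Rightarrow> nat" and m :: "'q \<Rightarrow> nat" and \<omega> :: "'p list"
  assumes "regular \<kappa> b" and "admissible \<kappa> b"
    and "(\<Sum>j\<in>UNIV. m j) = (\<Sum>i\<in>UNIV. n i) + 1"
    and "near_diagonal m"
    and "length \<omega> = (\<Sum>i\<in>UNIV. n i)"
    and "\<forall>i. count_list \<omega> i = n i"
  defines "U \<equiv> op_U \<kappa> b \<omega>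
      (laurent_monom (int (mstar m) - 1 - int (\<Sum>i\<in>UNIV. n i)) (vH b m))"
  shows "(\<exists>B. is_B_vector \<kappa> b n m B) \<and>
    (\<forall>B. is_B_vector \<kappa> b n m B \<longrightarrow>
       (\<exists>c. c \<noteq> 0 \<and> (\<forall>j. fps_to_fls (fps_of_poly (B j)) = fls_const c * U j))) \<and>
    (\<forall>h\<in>Hset m. \<exists>!B. is_B_vector \<kappa> b n m B \<and> lead_coeff (B h) = 1)"
proof -
  let ?is_B = "is_B_vector \<kappa> b n m"
  have b: "b j - b h \<notin> \<int>" if "j \<noteq> h" for j h
    using assms(1) that by (auto simp: regular_def)
  have "inj b"
    by (rule injI) (metis b diff_self Ints_0)
  have "laurent_vec U"
    unfolding U_def by (intro laurent_vec_op_U laurent_vec_laurent_monom)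
  have U: "moment_transform b U x = (\<Prod>i\<in>UNIV. \<Prod>l<n i. x - \<kappa> i - of_nat l) *
      (\<Prod>h\<in>UNIV. rGamma (x + of_nat (m h) + b h + 1))" for x
    unfolding U_def moment_transform_op_U[OF laurent_vec_laurent_monom \<open>inj b\<close>] assms(5)
      moment_transform_laurent_monom_vH[OF assms(4) \<open>inj b\<close>] by (simp add: assms(6))
  have B: "\<exists>c. c \<noteq> 0 \<and> (\<forall>j. fls_vec B j = fls_const c * U j) \<and>
      (\<forall>x. moment_transform b (fls_vec B) x = c * moment_transform b U x)" if "?is_B B" for B
  proof -
    obtain c where c: "\<And>x. moment_transform b (fls_vec B) x = c * moment_transform b U x"
      using moment_transform_B_vector[OF assms(1,2,4,3) \<open>?is_B B\<close>] unfolding U by blast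
    have eq: "fls_vec B j = fls_const c * U j" for j
      by (rule moment_transform_inject[OF laurent_vec_fls_vec \<open>laurent_vec U\<close> c b])
    moreover have "c \<noteq> 0"
      using that eq by (auto simp: is_B_vector_def fls_vec_def)
    ultimately show ?thesis using c by blast
  qed
  \<comment> \<open>Monic normalization needs a nonzero component h. If it vanished, so would the
    transform at -\<open>mstar m\<close> - b_h, where the top coefficient of component h is read
    off; the product formula for \<open>U\<close> is nonzero at this point.\<close>
  have nonzero: "B h \<noteq> 0" if "?is_B B" "h \<in> Hset m" for B h
  proof
    assume "B h = 0"
    have "mstar m > 0"
    proof (rule ccontr)
      assume "\<not> mstar m > 0"
      then have "m j = 0" for j
        using near_diagonal_cases[OF assms(4), of j] by (cases "j \<in> Hset m") auto
      then show False using assms(3) by simp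
    qed
    let ?x = "- of_nat (mstar m) - b h"
    have "fls_nth (fls_vec B l) t = 0" if "t > int (mstar m) - 1" for l t
    proof -
      have "m l \<le> nat t"
        using near_diagonal_cases[OF assms(4), of l] that by (cases "l \<in> Hset m") auto
      then show ?thesis
        using \<open>?is_B B\<close> by (simp add: fls_vec_nth is_B_vector_iff)
    qed
    from moment_transform_top_coeff[where T = "int (mstar m) - 1", OF this laurent_vec_fls_vec,
        where b = b and j = h] \<open>B h = 0\<close>
    have "moment_transform b (fls_vec B) ?x = 0"
      by (simp add: fls_vec_nth)
    with B[OF that(1)] have "moment_transform b U ?x = 0" by auto
    moreover have "?x - \<kappa> i - of_nat l \<noteq> 0" for i l
    proof
      assume "?x - \<kappa> i - of_nat l = 0"
      \<comment> \<open>Positivity of \<open>mstar m\<close> matters here: its predecessor k absorbs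
        the 1 in the admissibility condition.\<close>
      moreover obtain k where "mstar m = Suc k"
        using \<open>mstar m > 0\<close> gr0_conv_Suc by blast
      ultimately have "\<kappa> i + b h + 1 = - of_nat (l + k)"
        by (simp add: algebra_simps) (metis add.commute add.left_commute minus_add_cancel)
      then have "\<kappa> i + b h + 1 \<in> \<int>\<^sub>\<le>\<^sub>0"
        by (metis minus_of_nat_in_nonpos_Ints)
      with assms(2) show False by (auto simp: admissible_def)
    qed
    moreover have "rGamma (?x + of_nat (m l) + b l + 1) \<noteq> 0" for l
    proof (cases "l = h")
      case True
      then show ?thesis
        using that(2) by (simp add: near_diagonal_cases(1)[OF assms(4)])
    next
      case False
      show ?thesis
      proof
        assume "rGamma (?x + of_nat (m l) + b l + 1) = 0"
        then have "?x + of_nat (m l) + b l + 1 \<in> \<int>"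
          using nonpos_Ints_subset_Ints by (auto simp: rGamma_eq_zero_iff)
        then have "?x + of_nat (m l) + b l + 1 + of_int (int (mstar m) - int (m l) - 1) \<in> \<int>"
          by (rule Ints_add) (rule Ints_of_int)
        then have "b l - b h \<in> \<int>" by (simp add: algebra_simps)
        with b[OF False] show False by simp
      qed
    qed
    ultimately show False by (simp add: U)
  qed
  have ex: "\<exists>B. ?is_B B"
    by (rule exists_B_vector) (simp add: assms(3))
  have "\<exists>!B. ?is_B B \<and> lead_coeff (B h) = 1" if h: "h \<in> Hset m" for h
  proof -
    obtain B where "?is_B B" using ex by blast
    let ?B = "\<lambda>j. smult (inverse (lead_coeff (B h))) (B j)"
    have "?is_B ?B" "lead_coeff (?B h) = 1"
      using is_B_vector_smult[OF \<open>?is_B B\<close>] nonzero[OF \<open>?is_B B\<close> h] by auto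
    moreover have "B1 = B2"
      if B12: "?is_B B1" "lead_coeff (B1 h) = 1" "?is_B B2" "lead_coeff (B2 h) = 1" for B1 B2
    proof -
      from B[OF B12(1)] obtain c1 where c1: "c1 \<noteq> 0" "\<And>j. fls_vec B1 j = fls_const c1 * U j" by blast
      from B[OF B12(3)] obtain c2 where c2: "c2 \<noteq> 0" "\<And>j. fls_vec B2 j = fls_const c2 * U j" by blast
      have eq: "B1 j = smult (c1 / c2) (B2 j)" for j
      proof (rule poly_eqI)
        fix t
        have "fls_nth (fls_vec B1 j) (int t) = c1 / c2 * fls_nth (fls_vec B2 j) (int t)"
          using c2(1) by (simp add: c1 c2(2))
        then show "coeff (B1 j) t = coeff (smult (c1 / c2) (B2 j)) t"
          by (simp add: fls_vec_nth)
      qed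
      \<comment> \<open>Compare the leading coefficients of component h.\<close>
      have "c1 / c2 = 1"
        using B12(2,4) c1(1) c2(1) by (simp add: eq[of h] split: if_splits)
      then show ?thesis using eq by auto
    qed
    ultimately show ?thesis by blast
  qed
  with ex B show ?thesis unfolding fls_vec_def by blast
qed

end
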